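(* For every integer $n\ge 2$: (1) $v_{n+1}=v_n^2+v_nv_{n-1}+v_{n-1}^2-v_{n-1}^3-v_n-v_{n-1}+1$; (2) $v_{n+1}=v_n^2-v_n+1+\prod_{1\le i\le n-1}v_i$; (3) $v_{n+1}=1+\left(\prod_{1\le i\le n}v_i\right)\left(\sum_{1\le i\le n}\frac{1}{v_i}\right)$.
   Context: The sequence $(v_n)_{n\ge1}$ is defined recursively by $v_1=1$, $v_2=2$, and for $n\ge 2$ $$v_{n+1}=1+\frac{\sum_{1\le i\le n}\frac{1}{v_i}}{1-\sum_{1\le i<j\le n}\frac{1}{v_iv_j}}.$$ Its first terms are $1,2,4,15,219,47863,\dots$ *)

theory Defs
  imports Complex_Main
begin

text \<open>
  The value at index 0 is a dummy, as the sequence starts at index 1; it does not enter any of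
  the sums. The fourth equation is the recursion for \<open>v (n + 1)\<close>
  with \<open>n = Suc (Suc k) \<ge> 2\<close>, see \<open>v_rec\<close> below.
\<close>

fun v :: "nat \<Rightarrow> rat" where
  "v 0 = 0"
| "v (Suc 0) = 1"
| "v (Suc (Suc 0)) = 2"
| "v (Suc (Suc (Suc k))) =
     1 + (\<Sum>i\<in>{1..Suc (Suc k)}. 1 / v i) /
         (1 - (\<Sum>(i, j)\<in>{(i, j). 1 \<le> i \<and> i < j \<and> j \<le> Suc (Suc k)}. 1 / (v i * v j)))"

lemma v_1: "v 1 = 1" and v_2: "v 2 = 2"
  by (simp_all add: numeral_2_eq_2)

lemma v_rec:
  assumes "n \<ge> 2"
  shows "v (n + 1) = 1 + (\<Sum>i\<in>{1..n}. 1 / v i) /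
           (1 - (\<Sum>(i, j)\<in>{(i, j). 1 \<le> i \<and> i < j \<and> j \<le> n}. 1 / (v i * v j)))"
proof -
  from assms obtain k where "n = Suc (Suc k)"
    by (metis add_2_eq_Suc le_Suc_ex)
  then show ?thesis
    by (simp only: Suc_eq_plus1[symmetric] v.simps(4))
qed

end

(* Let P, S, E be the product of the first n terms, and the first and second elementary symmetric
   functions of their reciprocals. The invariant is P (1 - E) = 1: it turns the recursion
   into v (n + 1) = 1 + P S, and then P v (1 - E - S / v) = v - P S = 1 for v = v (n + 1).
   Splitting off the last term of P S gives (2), and eliminating the product from two
   consecutive instances of (2) gives (1). *)
theory Submission
  imports Defs
begin

text \<open>Splits off the pairs with second entry \<open>Suc n\<close>; applied to reciprocals it
  is the recurrence of the second elementary symmetric function,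
  \<open>E' = E + S / v (Suc n)\<close>.\<close>

lemma sum_ordered_pairs_Suc:
  fixes f :: "nat \<Rightarrow> nat \<Rightarrow> 'a::comm_monoid_add"
  shows "(\<Sum>(i, j)\<in>{(i, j). 1 \<le> i \<and> i < j \<and> j \<le> Suc n}. f i j) =
    (\<Sum>(i, j)\<in>{(i, j). 1 \<le> i \<and> i < j \<and> j \<le> n}. f i j) + (\<Sum>i\<in>{1..n}. f i (Suc n))"
proof -
  let ?A = "{(i, j). 1 \<le> i \<and> i < j \<and> j \<le> n}" and ?B = "(\<lambda>i. (i, Suc n)) ` {1..n}"
  have eq: "{(i, j). 1 \<le> i \<and> i < j \<and> j \<le> Suc n} = ?A \<union> ?B"
    by auto
  have "finite ?A"
    by (rule finite_subset[of _ "{..n} \<times> {..n}"]) auto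
  then have "sum (\<lambda>(i, j). f i j) (?A \<union> ?B) = sum (\<lambda>(i, j). f i j) ?A + sum (\<lambda>(i, j). f i j) ?B"
    by (intro sum.union_disjoint) auto
  then show ?thesis
    unfolding eq by (simp add: sum.reindex inj_on_def)
qed

text \<open>The three claims need each other in the induction: the formula for the next term shows
  that it is positive and preserves the invariant, and the new invariant turns the recursion into
  the next such formula.\<close>

lemma v_invariant:
  assumes "n \<ge> 1"
  shows "(\<forall>i\<in>{1..n}. v i > 0) \<and>
    (\<Prod>i\<in>{1..n}. v i) *
      (1 - (\<Sum>(i, j)\<in>{(i, j). 1 \<le> i \<and> i < j \<and> j \<le> n}. 1 / (v i * v j))) = 1 \<and>
    v (n + 1) = 1 + (\<Prod>i\<in>{1..n}. v i) * (\<Sum>i\<in>{1..n}. 1 / v i)"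
  using assms
proof (induction n rule: nat_induct_at_least)
  case base
  \<comment> \<open>\<open>v_rec\<close> does not reach \<open>n = 1\<close>: there are no pairs,
    and the formula is checked against the initial value \<open>v 2 = 2\<close>.\<close>
  have "(\<Sum>(i, j)\<in>{(i, j). 1 \<le> i \<and> i < j \<and> j \<le> (1::nat)}. 1 / (v i * v j)) = 0"
    by (rule sum.neutral) auto
  then show ?case
    using v_2 by simp
next
  case (Suc n)
  define P where "P = (\<Prod>i\<in>{1..n}. v i)"
  define S where "S = (\<Sum>i\<in>{1..n}. 1 / v i)"
  define E where "E = (\<Sum>(i, j)\<in>{(i, j). 1 \<le> i \<and> i < j \<and> j \<le> n}. 1 / (v i * v j))"
  define P' where "P' = (\<Prod>i\<in>{1..Suc n}. v i)"
  define S' where "S' = (\<Sum>i\<in>{1..Suc n}. 1 / v i)"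
  define E' where "E' = (\<Sum>(i, j)\<in>{(i, j). 1 \<le> i \<and> i < j \<and> j \<le> Suc n}. 1 / (v i * v j))"
  have pos: "\<forall>i\<in>{1..n}. v i > 0" and inv: "P * (1 - E) = 1" and v_Suc: "v (Suc n) = 1 + P * S"
    using Suc.IH by (auto simp: P_def S_def E_def)
  have "P \<ge> 0" "S \<ge> 0"
    unfolding P_def S_def using pos by (auto intro!: prod_nonneg sum_nonneg simp: less_imp_le)
  then have v_pos: "v (Suc n) > 0"
    unfolding v_Suc by (simp add: add_pos_nonneg)
  have pos': "\<forall>i\<in>{1..Suc n}. v i > 0"
    using pos v_pos by (auto simp: le_Suc_eq)
  have P': "P' = P * v (Suc n)"
    unfolding P'_def P_def by simp
  have E': "E' = E + S / v (Suc n)"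
    unfolding E'_def E_def S_def sum_ordered_pairs_Suc by (simp add: sum_divide_distrib)
  have "P' * (1 - E') = P * (1 - E) * v (Suc n) - P * S"
    unfolding P' E' using v_pos by (simp add: field_simps)
  also have "\<dots> = 1"
    unfolding inv v_Suc by simp
  finally have inv': "P' * (1 - E') = 1" .
  \<comment> \<open>\<open>P'\<close> is the inverse of \<open>1 - E'\<close>, so the division in
    the recursion becomes a multiplication by \<open>P'\<close>.\<close>
  then have "1 - E' \<noteq> 0"
    by auto
  with inv' have "S' / (1 - E') = P' * S'"
    by (simp add: nonzero_divide_eq_eq mult.assoc mult.left_commute[of P'])
  moreover have "v (Suc n + 1) = 1 + S' / (1 - E')"
    unfolding E'_def S'_def using Suc.hyps by (intro v_rec) simp
  ultimately have "v (Suc n + 1) = 1 + P' * S'"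
    by simp
  with pos' inv' show ?case
    unfolding P'_def E'_def S'_def by blast
qed

lemma v_pos:
  assumes "n \<ge> 1"
  shows "v n > 0"
  using v_invariant[OF assms] assms by simp

lemma v_Suc_eq_prod_sum:
  assumes "n \<ge> 1"
  shows "v (Suc n) = 1 + (\<Prod>i\<in>{1..n}. v i) * (\<Sum>i\<in>{1..n}. 1 / v i)"
  using v_invariant[OF assms] by simp

text \<open>With \<open>x = v (Suc n)\<close>, the product formula one index later reads
  \<open>1 + P * x * (S + 1 / x) = 1 + x * (P * S) + P\<close>, where
  \<open>P * S = x - 1\<close>.\<close>

lemma v_Suc_Suc_eq_prod:
  assumes "n \<ge> 1"
  shows "v (Suc (Suc n)) = v (Suc n) ^ 2 - v (Suc n) + 1 + (\<Prod>i\<in>{1..n}. v i)"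
proof -
  define P where "P = (\<Prod>i\<in>{1..n}. v i)"
  define S where "S = (\<Sum>i\<in>{1..n}. 1 / v i)"
  have PS: "P * S = v (Suc n) - 1"
    using v_Suc_eq_prod_sum[OF assms] unfolding P_def S_def by simp
  have "v (Suc (Suc n)) = 1 + P * v (Suc n) * (S + 1 / v (Suc n))"
    using v_Suc_eq_prod_sum[of "Suc n"] unfolding P_def S_def by simp
  also have "\<dots> = 1 + v (Suc n) * (P * S) + P"
    using v_pos[of "Suc n"] by (simp add: field_simps)
  finally show ?thesis
    unfolding PS unfolding P_def by (simp add: algebra_simps power2_eq_square)
qed

text \<open>Solve the previous lemma at \<open>n - 1\<close> for its product and multiply by
  \<open>v n\<close>.\<close>

lemma prod_v_eq:
  assumes "n \<ge> 1"
  shows "(\<Prod>i\<in>{1..n}. v i) = v (Suc n) * v n + v n ^ 2 - v n ^ 3 - v n"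
\<comment> \<open>The previous lemma cannot be used at index 0; for \<open>n = 1\<close> both sides
  are 1.\<close>
proof (cases "n = 1")
  case True
  then show ?thesis
    using v_2 by simp
next
  case False
  with assms obtain m where n: "n = Suc m" and "m \<ge> 1"
    by (cases n) auto
  have "(\<Prod>i\<in>{1..n}. v i) = v n * (\<Prod>i\<in>{1..m}. v i)"
    unfolding n by simp
  also have "(\<Prod>i\<in>{1..m}. v i) = v (Suc n) - v n ^ 2 + v n - 1"
    using v_Suc_Suc_eq_prod[OF \<open>m \<ge> 1\<close>] n by simp
  finally show ?thesis
    by (simp add: algebra_simps power2_eq_square power3_eq_cube)
qed

theorem theorem8:
  fixes n :: nat
  assumes "n \<ge> 2"
  shows "v (n + 1) = v n ^ 2 + v n * v (n - 1) + v (n - 1) ^ 2 - v (n - 1) ^ 3 - v n - v (n - 1) + 1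
    \<and> v (n + 1) = v n ^ 2 - v n + 1 + (\<Prod>i\<in>{1..n - 1}. v i)
    \<and> v (n + 1) = 1 + (\<Prod>i\<in>{1..n}. v i) * (\<Sum>i\<in>{1..n}. 1 / v i)"
proof -
  from assms obtain m where n: "n = Suc m" and m: "m \<ge> 1"
    by (cases n) auto
  have two: "v (n + 1) = v n ^ 2 - v n + 1 + (\<Prod>i\<in>{1..n - 1}. v i)"
    using v_Suc_Suc_eq_prod[OF m] n by simp
  \<comment> \<open>Inserting this value of the product into (2) leaves only \<open>v n\<close> and
    \<open>v (n - 1)\<close>, which is (1).\<close>
  have "(\<Prod>i\<in>{1..n - 1}. v i) = v n * v (n - 1) + v (n - 1) ^ 2 - v (n - 1) ^ 3 - v (n - 1)"
    using prod_v_eq[OF m] n by simp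
  with two have one: "v (n + 1) =
      v n ^ 2 + v n * v (n - 1) + v (n - 1) ^ 2 - v (n - 1) ^ 3 - v n - v (n - 1) + 1"
    by simp
  have three: "v (n + 1) = 1 + (\<Prod>i\<in>{1..n}. v i) * (\<Sum>i\<in>{1..n}. 1 / v i)"
    using v_Suc_eq_prod_sum[of n] assms by simp
  from one two three show ?thesis
    by blast
qed

end
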